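(* For every function $g : \omega \to \omega$ and every $n \geq 1$, there is a $g$-computable function $f : [\omega]^n \to 2^{n-1}$ such that every infinite $f$-thin set computes a function dominating $g$.
   Context: $[\omega]^n$ denotes the set of $n$-element subsets of $\omega$. Given $f : [\omega]^n \to k$, a set $H \subseteq \omega$ is $f$-thin if $|f[H]^n| \leq k-1$. A function $h$ dominates $g$ if $h(x) \geq g(x)$ for every $x$. *)

theory Defs
  imports "HOL-Library.Ramsey" "HOL-Library.FuncSet"
begin

text \<open>Partial recursive functions relative to an oracle \<open>orc :: nat \<Rightarrow> nat\<close>, as Kleene schemes
  acting on argument tuples (lists). The oracle is one of the initial functions; minimisation
  is over arguments below which the function is defined and nonzero.\<close>

datatype scheme =
    Zero
  | Succ
  | Proj nat
  | Oracle
  | Comp scheme "scheme list"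
  | PrimRec scheme scheme
  | Mu scheme

inductive eval :: "(nat \<Rightarrow> nat) \<Rightarrow> scheme \<Rightarrow> nat list \<Rightarrow> nat \<Rightarrow> bool" for orc where
  eval_Zero: "eval orc Zero xs 0"
| eval_Succ: "eval orc Succ [x] (Suc x)"
| eval_Proj: "i < length xs \<Longrightarrow> eval orc (Proj i) xs (xs ! i)"
| eval_Oracle: "eval orc Oracle [x] (orc x)"
| eval_Comp: "list_all2 (\<lambda>q y. eval orc q xs y) qs ys \<Longrightarrow> eval orc p ys z
    \<Longrightarrow> eval orc (Comp p qs) xs z"
| eval_PrimRec_0: "eval orc p xs y \<Longrightarrow> eval orc (PrimRec p q) (0 # xs) y"
| eval_PrimRec_Suc: "eval orc (PrimRec p q) (m # xs) y \<Longrightarrow> eval orc q (m # y # xs) z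
    \<Longrightarrow> eval orc (PrimRec p q) (Suc m # xs) z"
| eval_Mu: "eval orc p (m # xs) 0 \<Longrightarrow> (\<And>i. i < m \<Longrightarrow> \<exists>y. eval orc p (i # xs) (Suc y))
    \<Longrightarrow> eval orc (Mu p) xs m"
monos list_all2_mono

lemma eval_deterministic: "eval orc p xs y \<Longrightarrow> eval orc p xs z \<Longrightarrow> y = z"
proof (induction arbitrary: z rule: eval.induct)
  case (eval_Comp xs qs ys p w)
  from eval_Comp.prems obtain ys' where ys': "list_all2 (\<lambda>q y. eval orc q xs y) qs ys'"
    "eval orc p ys' z" by (cases rule: eval.cases) auto
  have "ys = ys'"
    using eval_Comp.IH(1) ys'(1) by (auto simp: list_all2_conv_all_nth intro!: nth_equalityI)
  then show ?case using eval_Comp.IH(2) ys'(2) by blast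
next
  case (eval_PrimRec_Suc p q m xs y w)
  from eval_PrimRec_Suc.prems obtain y' where "eval orc (PrimRec p q) (m # xs) y'"
    "eval orc q (m # y' # xs) z" by (cases rule: eval.cases) auto
  then show ?case using eval_PrimRec_Suc.IH by blast
next
  case (eval_Mu p m xs)
  from eval_Mu.prems have z: "eval orc p (z # xs) 0"
    "\<And>i. i < z \<Longrightarrow> \<exists>y. eval orc p (i # xs) (Suc y)" by (cases rule: eval.cases; auto)+
  show ?case
  proof (cases m z rule: linorder_cases)
    case less
    then show ?thesis using z(2) eval_Mu.IH(1) by fastforce
  next
    case greater
    then show ?thesis using z(1) eval_Mu.IH(2) by fastforce
  qed
qed (erule eval.cases; simp)+

definition computable_in :: "(nat \<Rightarrow> nat) \<Rightarrow> (nat \<Rightarrow> nat) \<Rightarrow> bool" where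
  "computable_in orc h \<longleftrightarrow> (\<exists>p. \<forall>x. eval orc p [x] (h x))"

definition set_computes :: "nat set \<Rightarrow> (nat \<Rightarrow> nat) \<Rightarrow> bool" where
  "set_computes H h \<longleftrightarrow> computable_in (\<lambda>x. if x \<in> H then 1 else 0) h"

text \<open>An \<open>n\<close>-element set is presented to a scheme as its increasing enumeration, an \<open>n\<close>-tuple.\<close>

definition computable_on_nsets :: "(nat \<Rightarrow> nat) \<Rightarrow> nat \<Rightarrow> (nat set \<Rightarrow> nat) \<Rightarrow> bool" where
  "computable_on_nsets orc n f \<longleftrightarrow>
    (\<exists>p. \<forall>A \<in> [UNIV]\<^bsup>n\<^esup>. eval orc p (sorted_list_of_set A) (f A))"

text \<open>For colourings \<open>f \<in> [UNIV]\<^bsup>n\<^esup> \<rightarrow> {..<k}\<close> only: then the image is finite, so that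
  \<^const>\<open>card\<close> is its cardinality, and \<open>k \<ge> 1\<close>, so that the subtraction does not truncate.\<close>

definition thin :: "nat \<Rightarrow> nat \<Rightarrow> (nat set \<Rightarrow> nat) \<Rightarrow> nat set \<Rightarrow> bool" where
  "thin n k f H \<longleftrightarrow> card (f ` [H]\<^bsup>n\<^esup>) \<le> k - 1"

definition dominates :: "(nat \<Rightarrow> nat) \<Rightarrow> (nat \<Rightarrow> nat) \<Rightarrow> bool" where
  "dominates h g \<longleftrightarrow> (\<forall>x. h x \<ge> g x)"

end

theory Submission
  imports Defs
begin

text \<open>Replace \<open>g\<close> by the nondecreasing \<open>G x = g 0 + \<dots> + g x\<close>, and colour a set
  \<open>x\<^sub>0 < \<dots> < x\<^sub>n\<^sub>-\<^sub>1\<close> by the \<open>n - 1\<close> bits telling which gaps are small, that is,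
  \<open>x\<^sub>i\<^sub>+\<^sub>1 \<le> G x\<^sub>i\<close>. If an infinite set \<open>H\<close> computes no function dominating \<open>g\<close>, then for all
  \<open>k\<close> and \<open>b\<close> the \<open>H\<close>-computable map sending \<open>x\<close> to the \<open>k\<close>-th successor in \<open>H\<close> of the least
  element of \<open>H\<close> above \<open>x + b\<close> lies below \<open>g\<close> at some \<open>x\<close>; this gives \<open>k\<close> consecutive small gaps
  in \<open>H\<close> above \<open>b\<close>. Such blocks can be separated by large gaps, as \<open>H\<close> is infinite, so every
  pattern of gaps occurs in \<open>H\<close>, and \<open>H\<close> is not thin.\<close>

subsection \<open>Schemes\<close>

lemma eval_Comp1: "eval orc q xs y \<Longrightarrow> eval orc p [y] z \<Longrightarrow> eval orc (Comp p [q]) xs z"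
  by (rule eval_Comp[where ys = "[y]"]) auto

lemma eval_Comp2:
  "eval orc q xs y \<Longrightarrow> eval orc r xs y' \<Longrightarrow> eval orc p [y, y'] z \<Longrightarrow> eval orc (Comp p [q, r]) xs z"
  by (rule eval_Comp[where ys = "[y, y']"]) auto

lemma eval_Proj_eq: "i < length xs \<Longrightarrow> xs ! i = y \<Longrightarrow> eval orc (Proj i) xs y"
  using eval_Proj by blast

definition add_scheme :: scheme where
  "add_scheme = PrimRec (Proj 0) (Comp Succ [Proj 1])"

lemma eval_add: "eval orc add_scheme [a, b] (a + b)"
  unfolding add_scheme_def
proof (induction a)
  case 0
  show ?case by (auto intro!: eval_PrimRec_0 eval_Proj_eq)
next
  case (Suc a)
  have "eval orc (Comp Succ [Proj 1]) [a, a + b, b] (Suc (a + b))"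
    by (rule eval_Comp1[OF eval_Proj_eq eval_Succ]) auto
  then show ?case using eval_PrimRec_Suc[OF Suc] by simp
qed

definition pred_scheme :: scheme where
  "pred_scheme = PrimRec Zero (Proj 0)"

lemma eval_pred: "eval orc pred_scheme [a] (a - 1)"
  unfolding pred_scheme_def
proof (induction a)
  case 0
  show ?case by (auto intro!: eval_PrimRec_0 eval_Zero)
next
  case (Suc a)
  then show ?case by (auto intro!: eval_PrimRec_Suc[OF Suc] eval_Proj_eq)
qed

text \<open>Recursion runs on the first argument, which is therefore the subtrahend.\<close>

definition monus_scheme :: scheme where
  "monus_scheme = PrimRec (Proj 0) (Comp pred_scheme [Proj 1])"

lemma eval_monus: "eval orc monus_scheme [a, b] (b - a)"
  unfolding monus_scheme_def
proof (induction a)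
  case 0
  show ?case by (auto intro!: eval_PrimRec_0 eval_Proj_eq)
next
  case (Suc a)
  have "eval orc (Comp pred_scheme [Proj 1]) [a, b - a, b] (b - a - 1)"
    by (rule eval_Comp1[OF eval_Proj_eq eval_pred]) auto
  then show ?case using eval_PrimRec_Suc[OF Suc] by simp
qed

definition is_zero_scheme :: scheme where
  "is_zero_scheme = PrimRec (Comp Succ [Zero]) Zero"

lemma eval_is_zero: "eval orc is_zero_scheme [a] (of_bool (a = 0))"
  unfolding is_zero_scheme_def
proof (induction a)
  case 0
  show ?case
    using eval_Succ[of orc 0] by (auto intro!: eval_PrimRec_0 eval_Comp1 eval_Zero)
next
  case (Suc a)
  then show ?case using eval_PrimRec_Suc[OF Suc eval_Zero] by simp
qed

definition sum_scheme :: scheme where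
  "sum_scheme = PrimRec (Comp Oracle [Zero])
    (Comp add_scheme [Proj 1, Comp Oracle [Comp Succ [Proj 0]]])"

lemma eval_sum: "eval orc sum_scheme [x] (\<Sum>i\<le>x. orc i)"
  unfolding sum_scheme_def
proof (induction x)
  case 0
  show ?case by (auto intro!: eval_PrimRec_0 eval_Comp1 eval_Zero eval_Oracle)
next
  case (Suc x)
  have "eval orc (Comp add_scheme [Proj 1, Comp Oracle [Comp Succ [Proj 0]]])
      [x, \<Sum>i\<le>x. orc i] ((\<Sum>i\<le>x. orc i) + orc (Suc x))"
    by (rule eval_Comp2[OF eval_Proj_eq eval_Comp1[OF eval_Comp1[OF eval_Proj_eq]] eval_add])
      (auto intro: eval_Succ eval_Oracle)
  then show ?case using eval_PrimRec_Suc[OF Suc] by simp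
qed

subsection \<open>Functions computable in an oracle\<close>

lemma computable_in_id: "computable_in orc id"
  unfolding computable_in_def by (auto intro!: exI[of _ "Proj 0"] eval_Proj_eq)

lemma computable_in_Suc: "computable_in orc Suc"
  unfolding computable_in_def by (auto intro!: exI[of _ Succ] eval_Succ)

lemma computable_in_comp:
  assumes "computable_in orc h" "computable_in orc h'"
  shows "computable_in orc (h \<circ> h')"
proof -
  from assms obtain p q where "\<And>x. eval orc p [x] (h x)" "\<And>x. eval orc q [x] (h' x)"
    unfolding computable_in_def by blast
  then have "eval orc (Comp p [q]) [x] ((h \<circ> h') x)" for x
    by (auto intro: eval_Comp1)
  then show ?thesis unfolding computable_in_def by blast
qed

lemma computable_in_funpow: "computable_in orc h \<Longrightarrow> computable_in orc (h ^^ k)"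
  by (induction k) (auto intro: computable_in_id computable_in_comp)

text \<open>\<open>Mu\<close> searches for the first zero, so \<open>p\<close> has to decide the
  negation of \<open>P\<close>; by \<open>ex\<close> the search ends for every
  \<open>x\<close>.\<close>

lemma computable_in_Least:
  fixes P :: "nat \<Rightarrow> nat \<Rightarrow> bool"
  assumes p: "\<And>m x. eval orc p [m, x] (of_bool (\<not> P m x))" and ex: "\<And>x. \<exists>m. P m x"
  shows "computable_in orc (\<lambda>x. LEAST m. P m x)"
proof -
  have "eval orc (Mu p) [x] (LEAST m. P m x)" for x
  proof (rule eval_Mu)
    show "eval orc p [LEAST m. P m x, x] 0"
      using p[of "LEAST m. P m x" x] LeastI_ex[OF ex[of x]] by simp
    show "\<exists>y. eval orc p [i, x] (Suc y)" if "i < (LEAST m. P m x)" for i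
      using p[of i x] not_less_Least[OF that] by (auto intro: exI[of _ 0])
  qed
  then show ?thesis unfolding computable_in_def by blast
qed

definition next_elem :: "nat set \<Rightarrow> nat \<Rightarrow> nat" where
  "next_elem H x = (LEAST m. m \<in> H \<and> x \<le> m)"

lemma next_elem:
  assumes "infinite H"
  shows "next_elem H x \<in> H" "x \<le> next_elem H x"
proof -
  have "\<exists>m. m \<in> H \<and> x \<le> m" using assms by (auto simp: infinite_nat_iff_unbounded_le)
  from LeastI_ex[OF this] show "next_elem H x \<in> H" "x \<le> next_elem H x"
    unfolding next_elem_def by auto
qed

lemma set_computes_next_elem:
  assumes "infinite H"
  shows "set_computes H (next_elem H)"
proof -
  let ?chi = "\<lambda>x. if x \<in> H then 1 else 0 :: nat"
  \<comment> \<open>The inner sum vanishes exactly when \<open>m\<close> lies in \<open>H\<close>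
    and \<open>x \<le> m\<close>; two zero tests turn it into the truth value of the
    negation.\<close>
  let ?p = "Comp is_zero_scheme [Comp is_zero_scheme
    [Comp add_scheme [Comp is_zero_scheme [Comp Oracle [Proj 0]], monus_scheme]]]"
  have "eval ?chi ?p [m, x] (of_bool (\<not> (m \<in> H \<and> x \<le> m)))" for m x
  proof -
    have "eval ?chi (Comp add_scheme [Comp is_zero_scheme [Comp Oracle [Proj 0]], monus_scheme])
        [m, x] (of_bool (?chi m = 0) + (x - m))"
      by (rule eval_Comp2[OF eval_Comp1[OF eval_Comp1[OF eval_Proj_eq eval_Oracle] eval_is_zero]
            eval_monus eval_add]) auto
    then have "eval ?chi ?p [m, x]
        (of_bool (of_bool (of_bool (?chi m = 0) + (x - m) = 0) = (0::nat)))"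
      by (intro eval_Comp1[OF eval_Comp1[OF _ eval_is_zero] eval_is_zero])
    moreover have "of_bool (of_bool (of_bool (?chi m = 0) + (x - m) = 0) = (0::nat)) =
        (of_bool (\<not> (m \<in> H \<and> x \<le> m)) :: nat)"
      by auto
    ultimately show ?thesis by metis
  qed
  moreover have "\<exists>m. m \<in> H \<and> x \<le> m" for x
    using next_elem[OF assms] by blast
  ultimately show ?thesis
    unfolding set_computes_def next_elem_def by (rule computable_in_Least)
qed

subsection \<open>Patterns of small and large gaps\<close>

fun gaps :: "(nat \<Rightarrow> nat) \<Rightarrow> nat list \<Rightarrow> bool list" where
  "gaps G (x # y # zs) = (y \<le> G x) # gaps G (y # zs)"
| "gaps G _ = []"

lemma length_gaps: "length (gaps G xs) = length xs - 1"
  by (induction G xs rule: gaps.induct) auto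

lemma gaps_append:
  "xs \<noteq> [] \<Longrightarrow> ys \<noteq> [] \<Longrightarrow> gaps G (xs @ ys) = gaps G xs @ (hd ys \<le> G (last xs)) # gaps G ys"
proof (induction G xs rule: gaps.induct)
  case ("2_2" G x)
  then show ?case by (cases ys) auto
qed auto

text \<open>There is one scheme for each position \<open>i\<close> and number \<open>m\<close> of
  remaining gaps. The gap at \<open>i\<close> is the lowest binary digit; the other digits are
  shifted by adding their value to itself.\<close>

fun gaps_scheme :: "nat \<Rightarrow> nat \<Rightarrow> scheme" where
  "gaps_scheme i 0 = Zero"
| "gaps_scheme i (Suc m) = Comp add_scheme
    [Comp is_zero_scheme [Comp monus_scheme [Comp sum_scheme [Proj i], Proj (Suc i)]],
     Comp add_scheme [gaps_scheme (Suc i) m, gaps_scheme (Suc i) m]]"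

lemma eval_gaps:
  "length xs = Suc (i + m) \<Longrightarrow> eval orc (gaps_scheme i m) xs
    (horner_sum of_bool 2 (gaps (\<lambda>x. \<Sum>j\<le>x. orc j) (drop i xs)))"
proof (induction m arbitrary: i)
  case 0
  then have "drop i xs = [xs ! i]"
    by (metis Cons_nth_drop_Suc add_0_right drop_all lessI order_refl)
  then show ?case by (auto intro: eval_Zero)
next
  case (Suc m)
  let ?G = "\<lambda>x. \<Sum>j\<le>x. orc j"
  let ?c = "horner_sum of_bool 2 (gaps ?G (drop (Suc i) xs)) :: nat"
  have drop: "drop i xs = xs ! i # xs ! Suc i # drop (Suc (Suc i)) xs"
    "drop (Suc i) xs = xs ! Suc i # drop (Suc (Suc i)) xs"
    using Suc.prems by (simp_all add: Cons_nth_drop_Suc)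
  have IH: "eval orc (gaps_scheme (Suc i) m) xs ?c"
    using Suc by simp
  have "eval orc (gaps_scheme i (Suc m)) xs
      (of_bool (xs ! Suc i - ?G (xs ! i) = 0) + (?c + ?c))"
    unfolding gaps_scheme.simps using Suc.prems
    by (intro eval_Comp2[OF eval_Comp1[OF eval_Comp2[OF eval_Comp1[OF eval_Proj eval_sum] eval_Proj
            eval_monus] eval_is_zero] eval_Comp2[OF IH IH eval_add] eval_add]) simp_all
  also have "of_bool (xs ! Suc i - ?G (xs ! i) = 0) + (?c + ?c) =
      horner_sum of_bool 2 (gaps ?G (drop i xs))"
    by (simp add: drop)
  finally show ?case .
qed

text \<open>Suppose \<open>k\<close> steps through \<open>H\<close> from some
  \<open>y \<ge> x + b\<close> end below \<open>g x\<close>. An element \<open>z\<close> of this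
  chain has \<open>z \<ge> x\<close>, and its successor in the chain is below
  \<open>g x \<le> G x \<le> G z\<close>, so every gap is small.\<close>

lemma small_block:
  fixes G :: "nat \<Rightarrow> nat"
  assumes H: "infinite H" and "mono G" and "\<And>x. g x \<le> G x"
    and no: "\<not> (\<exists>h. set_computes H h \<and> dominates h g)"
  obtains xs where "sorted_wrt (<) xs" "set xs \<subseteq> H" "\<forall>x\<in>set xs. b \<le> x"
    "xs \<noteq> []" "gaps G xs = replicate k True"
proof -
  define s where "s = next_elem H \<circ> Suc"
  let ?h = "(s ^^ k) \<circ> next_elem H \<circ> (Suc ^^ b)"
  have "set_computes H ?h"
    using set_computes_next_elem[OF H] unfolding set_computes_def s_def
    by (intro computable_in_comp computable_in_funpow computable_in_Suc)
  with no obtain x where x: "?h x < g x"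
    unfolding dominates_def by (meson not_le)
  define y where "y = next_elem H (x + b)"
  have hx: "?h x = (s ^^ k) y" by (simp add: y_def add.commute)
  have less: "z < s z" for z
    using next_elem(2)[OF H, of "Suc z"] by (simp add: s_def)
  have mem: "s z \<in> H" for z
    using next_elem(1)[OF H] by (simp add: s_def)
  have y: "y \<in> H" "x + b \<le> y"
    unfolding y_def using next_elem[OF H] by auto
  have pow: "(s ^^ i) z \<in> H \<and> z \<le> (s ^^ i) z" if "z \<in> H" for i z
  proof (induction i)
    case (Suc i)
    then show ?case using less[of "(s ^^ i) z"] mem by auto
  qed (use that in auto)
  \<comment> \<open>The start \<open>z\<close> varies and the head of \<open>xs\<close> is recorded,
    so that the induction can put \<open>z\<close> in front of a chain from \<open>s z\<close> and
    know the new gap.\<close>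
  have "\<exists>xs. sorted_wrt (<) xs \<and> set xs \<subseteq> H \<and> (\<forall>v\<in>set xs. z \<le> v) \<and> xs \<noteq> [] \<and> hd xs = z
      \<and> gaps G xs = replicate k True"
    if "z \<in> H" "x \<le> z" "(s ^^ k) z < g x" for z k
    using that
  proof (induction k arbitrary: z)
    case 0
    then show ?case by (intro exI[of _ "[z]"]) auto
  next
    case (Suc k)
    have sz: "s z \<in> H" "x \<le> s z" "(s ^^ k) (s z) < g x"
      using less[of z] mem Suc.prems by (auto simp: funpow_swap1)
    then obtain xs where xs: "sorted_wrt (<) xs" "set xs \<subseteq> H" "\<forall>v\<in>set xs. s z \<le> v" "xs \<noteq> []"
      "hd xs = s z" "gaps G xs = replicate k True"
      using Suc.IH by blast
    have "s z \<le> (s ^^ k) (s z)" using pow sz(1) by blast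
    also have "\<dots> \<le> G x" using sz(3) assms(3)[of x] by linarith
    also have "G x \<le> G z" using \<open>mono G\<close> Suc.prems(2) by (rule monoD)
    finally have "gaps G ([z] @ xs) = replicate (Suc k) True"
      using xs(4-6) by (subst gaps_append) auto
    then show ?case
      using xs less[of z] Suc.prems(1) by (intro exI[of _ "[z] @ xs"]) fastforce
  qed
  from this[of y k] obtain xs where "sorted_wrt (<) xs" "set xs \<subseteq> H" "\<forall>v\<in>set xs. y \<le> v"
    "xs \<noteq> []" "gaps G xs = replicate k True"
    using y x hx by auto
  then show thesis using y(2) by (intro that) auto
qed

text \<open>A small gap cannot be put in front of a list already chosen. The induction on
  \<open>ps\<close> therefore collects leading small gaps in the prefix, until a large gap or the
  end of \<open>ps\<close> lets \<open>small_block\<close> supply them all at once.\<close>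

lemma all_patterns:
  fixes G :: "nat \<Rightarrow> nat"
  assumes "infinite H" and "mono G" and "\<And>x. g x \<le> G x"
    and "\<not> (\<exists>h. set_computes H h \<and> dominates h g)"
  shows "\<exists>xs. sorted_wrt (<) xs \<and> set xs \<subseteq> H \<and> (\<forall>x\<in>set xs. b \<le> x) \<and> xs \<noteq> []
    \<and> gaps G xs = replicate k True @ ps"
proof (induction ps arbitrary: b k)
  case Nil
  then show ?case using small_block[OF assms, of b k] by (metis append_Nil2)
next
  case (Cons p ps)
  show ?case
  proof (cases p)
    case True
    then show ?thesis
      using Cons[of b "Suc k"] by (simp add: replicate_app_Cons_same)
  next
    case False
    obtain xs where xs: "sorted_wrt (<) xs" "set xs \<subseteq> H" "\<forall>x\<in>set xs. b \<le> x"
      "xs \<noteq> []" "gaps G xs = replicate k True"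
      using small_block[OF assms] by blast
    \<comment> \<open>The bound places \<open>ys\<close> above \<open>b\<close> and above all of
      \<open>xs\<close>, and makes the gap at the junction large. No small gaps are pending after
      it, hence the prefix of length 0.\<close>
    obtain ys where ys: "sorted_wrt (<) ys" "set ys \<subseteq> H"
      "\<forall>y\<in>set ys. Suc (Max (set xs) + b + G (last xs)) \<le> y" "ys \<noteq> []" "gaps G ys = ps"
      using Cons[of "Suc (Max (set xs) + b + G (last xs))" 0] by auto
    have "x < y" if "x \<in> set xs" "y \<in> set ys" for x y
      using Max_ge[OF finite_set that(1)] ys(3) that(2) by fastforce
    moreover have "\<not> hd ys \<le> G (last xs)"
      using ys(3,4) hd_in_set by fastforce
    ultimately show ?thesis
      using xs ys False
      by (intro exI[of _ "xs @ ys"]) (fastforce simp: sorted_wrt_append gaps_append)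
  qed
qed

theorem theorem3p2:
  fixes g :: "nat \<Rightarrow> nat" and n :: nat
  assumes "n \<ge> 1"
  shows "\<exists>f :: nat set \<Rightarrow> nat.
    f \<in> [UNIV]\<^bsup>n\<^esup> \<rightarrow> {..<2 ^ (n - 1)} \<and>
    computable_on_nsets g n f \<and>
    (\<forall>H. infinite H \<and> thin n (2 ^ (n - 1)) f H \<longrightarrow>
      (\<exists>h. set_computes H h \<and> dominates h g))"
proof -
  define G where "G = (\<lambda>x. \<Sum>j\<le>x. g j)"
  define f where "f A = (horner_sum of_bool 2 (gaps G (sorted_list_of_set A)) :: nat)" for A
  have f_range: "f A < 2 ^ (n - 1)" if "A \<in> [UNIV]\<^bsup>n\<^esup>" for A
    using horner_sum_of_bool_2_less[of "gaps G (sorted_list_of_set A)"] that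
    by (auto simp: f_def length_gaps nsets_def zless_nat_eq_int_zless)
  have "eval g (gaps_scheme 0 (n - 1)) (sorted_list_of_set A) (f A)" if "A \<in> [UNIV]\<^bsup>n\<^esup>" for A
    using eval_gaps[of "sorted_list_of_set A" 0 "n - 1" g] that assms
    by (auto simp: f_def G_def nsets_def)
  then have f_computable: "computable_on_nsets g n f"
    unfolding computable_on_nsets_def by blast
  have G: "mono G" "\<And>x. g x \<le> G x"
    by (auto simp: G_def intro!: monoI sum_mono2 member_le_sum)
  have "\<not> thin n (2 ^ (n - 1)) f H"
    if H: "infinite H" and no: "\<not> (\<exists>h. set_computes H h \<and> dominates h g)" for H
  proof -
    have "c \<in> f ` [H]\<^bsup>n\<^esup>" if "c < 2 ^ (n - 1)" for c
    proof -
      \<comment> \<open>The binary digits of \<open>c\<close>, lowest first, prescribe the gaps;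
        since \<open>c < 2 ^ (n - 1)\<close>, these digits determine \<open>c\<close>.\<close>
      obtain xs where xs: "sorted_wrt (<) xs" "set xs \<subseteq> H" "xs \<noteq> []"
        "gaps G xs = map (bit c) [0..<n - 1]"
        using all_patterns[OF H G no, of 0 0 "map (bit c) [0..<n - 1]"] by auto
      \<comment> \<open>Comparing lengths gives \<open>length xs - 1 = n - 1\<close>; neither side
        truncates, as \<open>xs\<close> is nonempty and \<open>n \<ge> 1\<close>.\<close>
      have "length xs = n"
        using arg_cong[OF xs(4), of length] xs(3) assms by (cases xs) (auto simp: length_gaps)
      then have "set xs \<in> [H]\<^bsup>n\<^esup>"
        using xs(1,2) by (auto simp: nsets_def strict_sorted_iff distinct_card)
      moreover have "f (set xs) = c"
        using xs(1,4) that
        by (simp add: f_def strict_sorted_iff sorted_list_of_set.idem_if_sorted_distinct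
            horner_sum_bit_eq_take_bit take_bit_nat_eq_self)
      ultimately show ?thesis by blast
    qed
    then have sub: "{..<2 ^ (n - 1)} \<subseteq> f ` [H]\<^bsup>n\<^esup>"
      by blast
    have "[H]\<^bsup>n\<^esup> \<subseteq> [UNIV]\<^bsup>n\<^esup>"
      by (rule nsets_mono) simp
    then have "f ` [H]\<^bsup>n\<^esup> \<subseteq> {..<2 ^ (n - 1)}"
      using f_range by auto
    with sub have "f ` [H]\<^bsup>n\<^esup> = {..<2 ^ (n - 1)}"
      by blast
    \<comment> \<open>All \<open>2 ^ (n - 1)\<close> colours occur, and this number is positive, so
      it exceeds \<open>2 ^ (n - 1) - 1\<close>.\<close>
    then show ?thesis
      by (simp add: thin_def not_le)
  qed
  then show ?thesis
    using f_range f_computable by (intro exI[of _ f]) auto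
qed

end
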